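(* Let $U$ be a vector space over a field $\Phi$ of characteristic different from $2,3,5$, and let $L,R,Q$ be linear operators on $U$ satisfying $$R^{2}-Q^{2}+LR-R=0,\quad RQ-QR+LQ-Q=0,\quad LR=RL,\quad LQ+QL-2Q=0,\quad (R-2L-1)(R-L)=0. \qquad( * )$$ Then $U$ is a direct sum $$U=U_{00}\oplus U_{\frac12\frac12}\oplus U_{11}\oplus U_{\frac32\frac32}\oplus U_{-\frac12 0}\oplus U_{01}\oplus U_{\frac12 2}\oplus U_{13},$$ where: 1) for any $a\in U_{\lambda\mu}$, $La=\lambda a$ and $Ra=\mu a$; 2) $Q(a)=0$ for all $a\in U_{00},\,U_{\frac12\frac12},\,U_{01},\,U_{-\frac12 0}$; 3) $U_{11}$ and $U_{13}$ are direct sums $U_{11}=U_{11}^{+}\oplus U_{11}^{-}$, $U_{13}=U_{13}^{+}\oplus U_{13}^{-}$, with $Q(a)=\pm a$ if $a\in U_{11}^{\pm}$ and $Q(a)=\pm3a$ if $a\in U_{13}^{\pm}$; 4) there is a (linear) one-to-one correspondence $\tau=\tau^{-1}$ between the subspaces $U_{\frac32\frac32}$ and $U_{\frac12 2}$ (that is, a linear map interchanging these two subspaces with $\tau^2=\mathrm{id}$) such that $Q(a)=\sqrt3\,\tau(a)$ for all $a\in U_{\frac32\frac32}$ and all $a\in U_{\frac12 2}$ (where $\sqrt3$ is a fixed square root of $3$, presupposed to lie in $\Phi$ for this item). Conversely, if a vector space $U$ over $\Phi$ is presented as a direct sum $U=U_{00}\oplus U_{\frac12\frac12}\oplus U_{11}\oplus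 U_{\frac32\frac32}\oplus U_{-\frac12 0}\oplus U_{01}\oplus U_{\frac12 2}\oplus U_{13}$ of eight subspaces (possibly zero) and three linear operators $L,R,Q$ on $U$ are defined by properties 1)–4), then the system of equations $( * )$ is fulfilled.
   Context: In the direct part, $U_{\lambda\mu}=\{a\in U: La=\lambda a,\ Ra=\mu a\}$ for $\lambda,\mu\in\Phi$. In equations of operators, $1$ denotes the identity operator. No finite-dimensionality assumption is stated. *)

theory Defs
  imports
    Complex_Main
    "HOL-Library.FuncSet"
begin

text \<open>Operator equations are stated pointwise; juxtaposition is composition, \<open>L R = L \<circ> R\<close>.
  The last equation is the composite of \<open>R - 2 L - 1\<close> with \<open>R - L\<close>.\<close>
definition operator_system ::
  "('k::field \<Rightarrow> 'v::ab_group_add \<Rightarrow> 'v) \<Rightarrow> ('v \<Rightarrow> 'v) \<Rightarrow> ('v \<Rightarrow> 'v) \<Rightarrow> ('v \<Rightarrow> 'v) \<Rightarrow> bool" where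
  "operator_system scale L R Q \<longleftrightarrow>
     (\<forall>a. R (R a) - Q (Q a) + L (R a) - R a = 0) \<and>
     (\<forall>a. R (Q a) - Q (R a) + L (Q a) - Q a = 0) \<and>
     (\<forall>a. L (R a) = R (L a)) \<and>
     (\<forall>a. L (Q a) + Q (L a) - scale 2 (Q a) = 0) \<and>
     (\<forall>a. (\<lambda>b. R b - scale 2 (L b) - b) (R a - L a) = 0)"

definition joint_eigenspace ::
  "('k::field \<Rightarrow> 'v::ab_group_add \<Rightarrow> 'v) \<Rightarrow> ('v \<Rightarrow> 'v) \<Rightarrow> ('v \<Rightarrow> 'v) \<Rightarrow> 'k \<Rightarrow> 'k \<Rightarrow> 'v set" where
  "joint_eigenspace scale L R l m = {a. L a = scale l a \<and> R a = scale m a}"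

text \<open>Internal direct sum of a finite family of subspaces (some possibly zero): every element of
  \<open>V\<close> is a sum of one component from each \<open>W i\<close> in exactly one way, and all such sums lie in \<open>V\<close>.\<close>
definition internal_direct_sum ::
  "('k::field \<Rightarrow> 'v::ab_group_add \<Rightarrow> 'v) \<Rightarrow> 'i set \<Rightarrow> ('i \<Rightarrow> 'v set) \<Rightarrow> 'v set \<Rightarrow> bool" where
  "internal_direct_sum scale I W V \<longleftrightarrow>
     finite I \<and> (\<forall>i\<in>I. module.subspace scale (W i)) \<and>
     bij_betw (\<lambda>f. \<Sum>i\<in>I. f i) (Pi\<^sub>E I W) V"

text \<open>The eight index pairs are pairwise distinct when the characteristic is not 2, 3 or 5, so a
  family indexed by this set is a family of exactly eight subspaces.\<close>
definition weights :: "('k::field \<times> 'k) set" where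
  "weights = {(0, 0), (1/2, 1/2), (1, 1), (3/2, 3/2), (- 1/2, 0), (0, 1), (1/2, 2), (1, 3)}"

definition acts_by_weights ::
  "('k::field \<Rightarrow> 'v::ab_group_add \<Rightarrow> 'v) \<Rightarrow> ('v \<Rightarrow> 'v) \<Rightarrow> ('v \<Rightarrow> 'v) \<Rightarrow> ('k \<Rightarrow> 'k \<Rightarrow> 'v set) \<Rightarrow> bool" where
  "acts_by_weights scale L R U \<longleftrightarrow>
     (\<forall>(l, m)\<in>weights. \<forall>a\<in>U l m. L a = scale l a \<and> R a = scale m a)"

definition kills_four :: "('v::ab_group_add \<Rightarrow> 'v) \<Rightarrow> ('k::field \<Rightarrow> 'k \<Rightarrow> 'v set) \<Rightarrow> bool" where
  "kills_four Q U \<longleftrightarrow>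
     (\<forall>a \<in> U 0 0 \<union> U (1/2) (1/2) \<union> U 0 1 \<union> U (- 1/2) 0. Q a = 0)"

text \<open>The superscripts \<open>+\<close> and \<open>-\<close> are encoded as the field elements \<open>1\<close> and \<open>-1\<close>, which are
  distinct in characteristic different from 2.\<close>
definition splits_by_sign ::
  "('k::field \<Rightarrow> 'v::ab_group_add \<Rightarrow> 'v) \<Rightarrow> ('v \<Rightarrow> 'v) \<Rightarrow> ('k \<Rightarrow> 'k \<Rightarrow> 'v set) \<Rightarrow> bool" where
  "splits_by_sign scale Q U \<longleftrightarrow>
     (\<exists>U11 U13 :: 'k \<Rightarrow> 'v set.
        internal_direct_sum scale {1, - 1} U11 (U 1 1) \<and>
        internal_direct_sum scale {1, - 1} U13 (U 1 3) \<and>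
        (\<forall>e\<in>{1, - 1}. \<forall>a\<in>U11 e. Q a = scale e a) \<and>
        (\<forall>e\<in>{1, - 1}. \<forall>a\<in>U13 e. Q a = scale (e * 3) a))"

text \<open>The map \<open>t\<close> only matters on \<open>A + B\<close>; its values elsewhere are irrelevant.\<close>
definition linear_interchange ::
  "('k::field \<Rightarrow> 'v::ab_group_add \<Rightarrow> 'v) \<Rightarrow> 'v set \<Rightarrow> 'v set \<Rightarrow> ('v \<Rightarrow> 'v) \<Rightarrow> bool" where
  "linear_interchange scale A B t \<longleftrightarrow>
     (let S = module.span scale (A \<union> B) in
        (\<forall>x\<in>S. \<forall>y\<in>S. t (x + y) = t x + t y) \<and>
        (\<forall>c. \<forall>x\<in>S. t (scale c x) = scale c (t x)) \<and>
        t ` A = B \<and> t ` B = A \<and>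
        (\<forall>x\<in>S. t (t x) = x))"

text \<open>The parameter \<open>s\<close> is the chosen square root of 3.\<close>
definition acts_by_interchange ::
  "('k::field \<Rightarrow> 'v::ab_group_add \<Rightarrow> 'v) \<Rightarrow> 'k \<Rightarrow> ('v \<Rightarrow> 'v) \<Rightarrow> ('k \<Rightarrow> 'k \<Rightarrow> 'v set) \<Rightarrow> bool" where
  "acts_by_interchange scale s Q U \<longleftrightarrow>
     (\<exists>t. linear_interchange scale (U (3/2) (3/2)) (U (1/2) 2) t \<and>
          (\<forall>a \<in> U (3/2) (3/2) \<union> U (1/2) 2. Q a = scale s (t a)))"

end

theory Submission
  imports Defs
begin

text \<open>The system says \<open>L Q = Q (2 - L)\<close>, \<open>R Q = Q (R + L - 1)\<close>, \<open>Q\<^sup>2 = R (R + L - 1)\<close> and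
  \<open>(R - 2 L - 1) (R - L) = 0\<close>. Moving \<open>Q\<close> to the left of the last relation and multiplying by \<open>Q\<close>
  gives \<open>R (R + L - 1) (R + 3 L - 6) (R + 2 L - 3) = 0\<close>. On the kernels of \<open>R - L\<close> and of
  \<open>R - 2 L - 1\<close> this is, up to a nonzero factor, a product of four distinct factors \<open>L - c\<close>, so both
  kernels are sums of weight spaces. They contain the image of
  \<open>L + 1 = (R - L) - (R - 2 L - 1)\<close>; since \<open>-1\<close> is not an eigenvalue of \<open>L\<close>, neither on a weight space
  nor, by the quartic relation, on the whole space, the weight spaces span everything. Finally \<open>Q\<close> maps
  the weight space of \<open>(\<lambda>, \<mu>)\<close> to that of \<open>(2 - \<lambda>, \<mu> + \<lambda> - 1)\<close>, and \<open>Q\<^sup>2\<close> acts on it as the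
  scalar \<open>\<mu> (\<mu> + \<lambda> - 1)\<close>.\<close>

section \<open>Direct sums and spans of eigenvectors\<close>

primrec shifts :: "('k \<Rightarrow> 'v::minus \<Rightarrow> 'v) \<Rightarrow> ('v \<Rightarrow> 'v) \<Rightarrow> 'k list \<Rightarrow> 'v \<Rightarrow> 'v" where
  "shifts scale T [] x = x"
| "shifts scale T (c # cs) x = shifts scale T cs (T x - scale c x)"

context vector_space
begin

text \<open>Applying \<open>indep\<close> to the difference of two families with equal sums gives
  uniqueness, so only decompositions of zero have to be examined.\<close>

lemma internal_direct_sumI:
  assumes fin: "finite I"
    and sub: "\<And>i. i \<in> I \<Longrightarrow> subspace (W i)"
    and V: "subspace V" "\<And>i. i \<in> I \<Longrightarrow> W i \<subseteq> V" "V \<subseteq> span (\<Union>i\<in>I. W i)"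
    and indep: "\<And>f i. \<lbrakk>\<And>i. i \<in> I \<Longrightarrow> f i \<in> W i; (\<Sum>i\<in>I. f i) = 0; i \<in> I\<rbrakk> \<Longrightarrow> f i = 0"
  shows "internal_direct_sum scale I W V"
proof -
  let ?S = "\<lambda>f. \<Sum>i\<in>I. f i"
  have inj: "inj_on ?S (Pi\<^sub>E I W)"
  proof (rule inj_onI)
    fix f g assume f: "f \<in> Pi\<^sub>E I W" and g: "g \<in> Pi\<^sub>E I W" and eq: "?S f = ?S g"
    have "f i - g i = 0" if "i \<in> I" for i
    proof (rule indep[of "\<lambda>i. f i - g i"])
      show "f j - g j \<in> W j" if "j \<in> I" for j
        using f g that by (auto intro!: subspace_diff[OF sub])
    qed (use eq that in \<open>auto simp: sum_subtractf\<close>)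
    then show "f = g"
      using f g by (auto intro: PiE_ext)
  qed
  have "V \<subseteq> ?S ` Pi\<^sub>E I W"
  proof
    fix x assume "x \<in> V"
    then have "x \<in> span (\<Union>i\<in>I. W i)" using V by auto
    then have "\<exists>f. (\<forall>i\<in>I. f i \<in> W i) \<and> x = ?S f"
    proof (induction rule: span_induct_alt)
      case base
      show ?case by (rule exI[of _ "\<lambda>_. 0"]) (auto intro: subspace_0 sub)
    next
      case (step c y z)
      then obtain f j where f: "\<forall>i\<in>I. f i \<in> W i" "z = ?S f" and j: "j \<in> I" "y \<in> W j"
        by auto
      show ?case
      proof (intro exI conjI ballI)
        show "f i + (if i = j then scale c y else 0) \<in> W i" if "i \<in> I" for i
          using f j that by (auto intro!: subspace_add subspace_scale sub)
        show "scale c y + z = (\<Sum>i\<in>I. f i + (if i = j then scale c y else 0))"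
          using f j fin by (simp add: sum.distrib add.commute)
      qed
    qed
    then obtain f where f: "\<forall>i\<in>I. f i \<in> W i" "x = ?S f" by auto
    show "x \<in> ?S ` Pi\<^sub>E I W"
      by (rule image_eqI[of _ _ "restrict f I"]) (use f in auto)
  qed
  moreover have "?S ` Pi\<^sub>E I W \<subseteq> V"
    using V by (auto intro!: subspace_sum)
  ultimately show ?thesis
    using inj fin sub by (auto simp: internal_direct_sum_def bij_betw_def)
qed

text \<open>For the converse: the vectors satisfying a linear system form a subspace, so it can be
  checked one summand at a time.\<close>

lemma internal_direct_sum_subset:
  assumes "internal_direct_sum scale I W V" and "subspace P"
    and "\<And>i. i \<in> I \<Longrightarrow> W i \<subseteq> P"
  shows "V \<subseteq> P"
proof
  fix x assume "x \<in> V"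
  then obtain f where "f \<in> Pi\<^sub>E I W" "x = (\<Sum>i\<in>I. f i)"
    using assms(1) by (auto simp: internal_direct_sum_def bij_betw_def)
  then show "x \<in> P"
    using assms(2,3) by (auto intro!: subspace_sum)
qed

lemma internal_direct_sum_component_subset:
  assumes sum: "internal_direct_sum scale I W V" and i: "i \<in> I"
  shows "W i \<subseteq> V"
proof
  fix x assume x: "x \<in> W i"
  let ?f = "\<lambda>j\<in>I. if j = i then x else 0"
  have "?f \<in> Pi\<^sub>E I W"
    using sum x by (auto simp: internal_direct_sum_def intro!: subspace_0)
  then have "(\<Sum>j\<in>I. ?f j) \<in> V"
    using sum unfolding internal_direct_sum_def bij_betw_def by blast
  then show "x \<in> V"
    using sum i by (simp add: internal_direct_sum_def)
qed

text \<open>On an eigenvector for \<open>c \<noteq> a\<close> the map \<open>T - a\<close> is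
  multiplication by the invertible scalar \<open>c - a\<close>; preimages are then added up along
  the span.\<close>

lemma shift_surj_on_span_eigenvectors:
  assumes T: "Vector_Spaces.linear scale scale T"
    and eig: "\<And>v. v \<in> E \<Longrightarrow> \<exists>c. c \<noteq> a \<and> T v = scale c v"
    and y: "y \<in> span E"
  shows "\<exists>z\<in>span E. T z - scale a z = y"
  using y
proof (induction rule: span_induct_alt)
  interpret T: Vector_Spaces.linear scale scale T by (rule T)
  case base
  show ?case by (rule bexI[of _ 0]) (auto simp: T.zero span_zero)
next
  interpret T: Vector_Spaces.linear scale scale T by (rule T)
  case (step k v y)
  then obtain z c where z: "z \<in> span E" "T z - scale a z = y" and c: "c \<noteq> a" "T v = scale c v"
    using eig by blast
  have *: "scale (c * (k / (c - a))) v - scale (a * (k / (c - a))) v = scale k v"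
    using c by (simp only: scale_left_diff_distrib[symmetric] left_diff_distrib[symmetric]) simp
  show ?case
  proof (rule bexI)
    show "scale (k / (c - a)) v + z \<in> span E"
      using step.hyps by (intro span_add[OF span_scale[OF span_base] z(1)])
    show "T (scale (k / (c - a)) v + z) - scale a (scale (k / (c - a)) v + z) = scale k v + y"
      using * c z(2)[symmetric]
      by (simp add: T.add T.scale scale_right_distrib algebra_simps)
  qed
qed

text \<open>Induction peels off one factor. By induction \<open>(T - a) x\<close> is a sum of
  eigenvectors for the other values, so it equals \<open>(T - a) z\<close> with \<open>z\<close> in
  their span; then \<open>x - z\<close> is an eigenvector for \<open>a\<close>. Invariance of
  \<open>K\<close> keeps all these vectors inside \<open>K\<close>.\<close>

lemma in_span_eigenvectors:
  assumes T: "Vector_Spaces.linear scale scale T"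
    and K: "subspace K" "\<And>v. v \<in> K \<Longrightarrow> T v \<in> K"
  shows "distinct cs \<Longrightarrow> x \<in> K \<Longrightarrow> shifts scale T cs x = 0
    \<Longrightarrow> x \<in> span (\<Union>c\<in>set cs. {v \<in> K. T v = scale c v})"
proof (induction cs arbitrary: x)
  case Nil
  then show ?case by (simp add: span_zero)
next
  interpret T: Vector_Spaces.linear scale scale T by (rule T)
  case (Cons a cs)
  let ?E = "\<Union>c\<in>set cs. {v \<in> K. T v = scale c v}"
  have "T x - scale a x \<in> K"
    using Cons.prems K by (auto intro: subspace_diff subspace_scale)
  then have "T x - scale a x \<in> span ?E"
    using Cons by auto
  moreover have "\<exists>c. c \<noteq> a \<and> T v = scale c v" if "v \<in> ?E" for v
    using that Cons.prems by auto
  ultimately obtain z where z: "z \<in> span ?E" "T z - scale a z = T x - scale a x"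
    using shift_surj_on_span_eigenvectors[OF T] by meson
  have "span ?E \<subseteq> K"
    using K by (intro span_minimal) auto
  then have "x - z \<in> K"
    using z Cons.prems K by (auto intro: subspace_diff)
  moreover have "T (x - z) = scale a (x - z)"
    using z(2) by (simp add: T.diff scale_right_diff_distrib algebra_simps)
  ultimately have "x - z \<in> span (\<Union>c\<in>set (a # cs). {v \<in> K. T v = scale c v})"
    by (intro span_base) auto
  moreover have "z \<in> span (\<Union>c\<in>set (a # cs). {v \<in> K. T v = scale c v})"
    using z(1) span_mono[of ?E "\<Union>c\<in>set (a # cs). {v \<in> K. T v = scale c v}"] by auto
  ultimately show ?case
    using span_add by fastforce
qed

text \<open>Applying \<open>L - fst p\<close> and \<open>R - snd p\<close> to a vanishing sum
  removes its \<open>p\<close>-term and rescales the others. The induction hypothesis kills both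
  rescaled families, and for \<open>w \<noteq> p\<close> at least one of the two scalars is
  nonzero.\<close>

lemma joint_eigenvectors_independent:
  assumes "Vector_Spaces.linear scale scale L" and "Vector_Spaces.linear scale scale R"
  shows "finite W \<Longrightarrow> (\<And>l m. (l, m) \<in> W \<Longrightarrow> f (l, m) \<in> joint_eigenspace scale L R l m)
    \<Longrightarrow> (\<Sum>w\<in>W. f w) = 0 \<Longrightarrow> w \<in> W \<Longrightarrow> f w = 0"
proof (induction W arbitrary: f w rule: finite_induct)
  case empty
  then show ?case by simp
next
  interpret L: Vector_Spaces.linear scale scale L by fact
  interpret R: Vector_Spaces.linear scale scale R by fact
  case (insert p W)
  have L: "L (f w) = scale (fst w) (f w)" and R: "R (f w) = scale (snd w) (f w)"
    if "w \<in> insert p W" for w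
    using insert.prems(1)[of "fst w" "snd w"] that by (auto simp: joint_eigenspace_def)
  have sum0: "f p + (\<Sum>w\<in>W. f w) = 0"
    using insert by simp
  have "(\<Sum>w\<in>W. scale (fst w - fst p) (f w))
      = (L (f p) + (\<Sum>w\<in>W. L (f w))) - scale (fst p) (f p + (\<Sum>w\<in>W. f w))"
    by (simp add: L scale_left_diff_distrib sum_subtractf scale_sum_right scale_right_distrib)
  also have "\<dots> = 0"
    using sum0 by (simp flip: L.sum L.add add: L.zero)
  finally have Lsum: "(\<Sum>w\<in>W. scale (fst w - fst p) (f w)) = 0" .
  have "(\<Sum>w\<in>W. scale (snd w - snd p) (f w))
      = (R (f p) + (\<Sum>w\<in>W. R (f w))) - scale (snd p) (f p + (\<Sum>w\<in>W. f w))"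
    by (simp add: R scale_left_diff_distrib sum_subtractf scale_sum_right scale_right_distrib)
  also have "\<dots> = 0"
    using sum0 by (simp flip: R.sum R.add add: R.zero)
  finally have Rsum: "(\<Sum>w\<in>W. scale (snd w - snd p) (f w)) = 0" .
  have scaled: "scale c (f (l, m)) \<in> joint_eigenspace scale L R l m" if "(l, m) \<in> W" for l m c
    using L[of "(l, m)"] R[of "(l, m)"] that
    by (auto simp: joint_eigenspace_def L.scale R.scale mult.commute)
  have 0: "f w = 0" if "w \<in> W" for w
  proof -
    have "scale (fst w - fst p) (f w) = 0"
      by (rule insert.IH[OF scaled Lsum that])
    moreover have "scale (snd w - snd p) (f w) = 0"
      by (rule insert.IH[OF scaled Rsum that])
    moreover have "w \<noteq> p" using that insert by auto
    ultimately show ?thesis by (auto simp: prod_eq_iff)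
  qed
  then have "f p = 0" using sum0 by simp
  with 0 insert.prems(3) show ?case by blast
qed

text \<open>On \<open>E\<close> the map \<open>Q / c\<close> is an involution, so \<open>E\<close>
  is the sum of its eigenspaces for 1 and -1.\<close>

lemma involution_splits:
  assumes Q: "Vector_Spaces.linear scale scale Q"
    and E: "subspace E" "\<And>a. a \<in> E \<Longrightarrow> Q a \<in> E" "\<And>a. a \<in> E \<Longrightarrow> Q (Q a) = scale (c * c) a"
    and nz: "(2 :: 'a) \<noteq> 0" "c \<noteq> 0"
  shows "internal_direct_sum scale {1, - 1} (\<lambda>e. {a \<in> E. Q a = scale (e * c) a}) E"
proof (rule internal_direct_sumI)
  interpret Q: Vector_Spaces.linear scale scale Q by (rule Q)
  let ?W = "\<lambda>e. {a \<in> E. Q a = scale (e * c) a}"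
  have ne: "(1 :: 'a) \<noteq> - 1"
    using nz(1) by (simp add: eq_neg_iff_add_eq_0)
  show "subspace (?W e)" for e
    using E(1)
    by (auto simp: subspace_def Q.zero Q.add Q.scale scale_right_distrib mult.commute)
  show "E \<subseteq> span (\<Union>e\<in>{1, - 1}. ?W e)"
  proof
    fix a assume a: "a \<in> E"
    \<comment> \<open>The projections \<open>(1 + e Q / c) / 2\<close> onto the two eigenspaces;
      they add up to the identity.\<close>
    let ?p = "\<lambda>e. scale (1/2) (a + scale (e / c) (Q a))"
    have "?p e \<in> ?W e" if "e \<in> {1, - 1}" for e
    proof -
      have "e * e = 1" using that by auto
      then have "Q (?p e) = scale (e * c) (?p e)"
        using E(3)[OF a] nz by (simp add: Q.add Q.scale scale_right_distrib mult.commute add.commute)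
      then show ?thesis
        using E a by (simp add: subspace_add subspace_scale)
    qed
    then have "?p 1 + ?p (- 1) \<in> span (\<Union>e\<in>{1, - 1}. ?W e)"
      by (intro span_add span_base) blast+
    moreover have "?p 1 + ?p (- 1) = scale (1/2 + 1/2) a"
      unfolding scale_left_distrib by (simp add: scale_right_distrib scale_right_diff_distrib)
    ultimately show "a \<in> span (\<Union>e\<in>{1, - 1}. ?W e)"
      using nz by simp
  qed
  show "f e = 0" if f: "\<And>e. e \<in> {1, - 1} \<Longrightarrow> f e \<in> ?W e" and sum: "(\<Sum>e\<in>{1, - 1}. f e) = 0"
    and e: "e \<in> {1, - 1}" for f e
  proof -
    \<comment> \<open>Applying \<open>Q\<close> to this relation reverses its sign, so both
      components vanish after division by 2.\<close>
    have s: "f 1 = - f (- 1)"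
      using sum ne by (simp add: eq_neg_iff_add_eq_0)
    have "scale c (f 1) = Q (f 1)" using f[of 1] by simp
    also have "\<dots> = - Q (f (- 1))" unfolding s by (simp add: Q.neg)
    also have "\<dots> = scale c (f (- 1))" using f[of "- 1"] by simp
    finally have f1: "f 1 = f (- 1)"
      using nz by simp
    with s have "scale 2 (f (- 1)) = 0"
      unfolding one_add_one[symmetric] scale_left_distrib by (simp add: eq_neg_iff_add_eq_0)
    with f1 e nz show ?thesis by auto
  qed
qed (use E in auto)

end

section \<open>Three operators and arithmetic of the weights\<close>

locale three_operators = vector_space scale
  + L: Vector_Spaces.linear scale scale L
  + R: Vector_Spaces.linear scale scale R
  + Q: Vector_Spaces.linear scale scale Q
  for scale :: "'k::field \<Rightarrow> 'v::ab_group_add \<Rightarrow> 'v" and L R Q +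
  assumes two [simp]: "(2 :: 'k) \<noteq> 0"
    and three [simp]: "(3 :: 'k) \<noteq> 0"
    and five [simp]: "(5 :: 'k) \<noteq> 0"
begin

abbreviation U :: "'k \<Rightarrow> 'k \<Rightarrow> 'v set" where
  "U \<equiv> joint_eigenspace scale L R"

lemmas operator_simps =
  L.add L.diff L.scale L.neg L.zero R.add R.diff R.scale R.neg R.zero
  Q.add Q.diff Q.scale Q.neg Q.zero

text \<open>Turns numeral multiples into repeated sums, so that operator identities with integer
  coefficients become identities in an abelian group.\<close>

lemma scale_numeral:
  "scale (numeral num.One) a = a"
  "scale (numeral (num.Bit0 n)) a = scale (numeral n) a + scale (numeral n) a"
  "scale (numeral (num.Bit1 n)) a = scale (numeral n) a + scale (numeral n) a + a"
  by (simp_all only: numeral_One numeral_Bit0 numeral_Bit1 scale_left_distrib scale_one)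

lemma zero_neq [simp]: "(0 :: 'k) \<noteq> 2" "(0 :: 'k) \<noteq> 3" "(0 :: 'k) \<noteq> 5"
  using two three five by metis+

lemma four [simp]: "(4 :: 'k) \<noteq> 0"
  using mult_eq_0_iff[of "2 :: 'k" 2] by simp

lemma numeral_nonzero [simp]:
  "(6 :: 'k) \<noteq> 0" "(8 :: 'k) \<noteq> 0" "(10 :: 'k) \<noteq> 0" "(12 :: 'k) \<noteq> 0" "(15 :: 'k) \<noteq> 0"
  "(16 :: 'k) \<noteq> 0" "(32 :: 'k) \<noteq> 0"
  using mult_eq_0_iff[of "2 :: 'k" 3] mult_eq_0_iff[of "2 :: 'k" 4] mult_eq_0_iff[of "2 :: 'k" 5]
    mult_eq_0_iff[of "4 :: 'k" 4] mult_eq_0_iff[of "4 :: 'k" 8] mult_eq_0_iff[of "3 :: 'k" 4] mult_eq_0_iff[of "3 :: 'k" 5]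
  by simp_all

lemma numeral_distinct [simp]:
  "(2 :: 'k) \<noteq> 1" "(3 :: 'k) \<noteq> 1" "(3 :: 'k) \<noteq> 2" "(2 :: 'k) \<noteq> - 1"
  "(1 :: 'k) \<noteq> - 1" "(1 :: 'k) \<noteq> - 2" "(3 :: 'k) \<noteq> - 2"
  using right_minus_eq[of "2 :: 'k" 1] right_minus_eq[of "3 :: 'k" 1] right_minus_eq[of "3 :: 'k" 2]
    right_minus_eq[of "2 :: 'k" "- 1"] right_minus_eq[of "1 :: 'k" "- 1"]
    right_minus_eq[of "1 :: 'k" "- 2"] right_minus_eq[of "3 :: 'k" "- 2"]
  by simp_all

lemma numeral_distinct' [simp]:
  "(1 :: 'k) \<noteq> 2" "(2 :: 'k) \<noteq> 3" "(6 :: 'k) \<noteq> 2" "- (1/2 :: 'k) \<noteq> 1"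
  using right_minus_eq[of "1 :: 'k" 2] right_minus_eq[of "2 :: 'k" 3] right_minus_eq[of "6 :: 'k" 2]
    right_minus_eq[of "- (1/2) :: 'k" 1]
  by (simp_all add: minus_equation_iff[of "1/2"] eq_divide_eq)

text \<open>The values of \<open>l + 1\<close> are 1, 3/2, 2, 5/2 and 1/2, nonzero because 2, 3 and
  5 are.\<close>

lemma weights_neq_minus_one: "(l, m) \<in> weights \<Longrightarrow> l \<noteq> (- 1 :: 'k)"
  using two three five by (auto simp: weights_def divide_eq_eq simp del: two three five)

lemma subspace_joint_eigenspace: "subspace (U l m)"
  by (auto simp: subspace_def joint_eigenspace_def operator_simps scale_right_distrib mult.commute)

end

section \<open>Commutation rules and the quartic relation\<close>

locale three_operators_system = three_operators scale L R Q
  for scale :: "'k::field \<Rightarrow> 'v::ab_group_add \<Rightarrow> 'v" and L R Q +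
  assumes system: "operator_system scale L R Q"
begin

lemma system_at:
  "R (R a) - Q (Q a) + L (R a) - R a = 0"
  "R (Q a) - Q (R a) + L (Q a) - Q a = 0"
  "L (Q a) + Q (L a) - scale 2 (Q a) = 0"
  using system unfolding operator_system_def by blast+

lemma LR: "L (R a) = R (L a)"
  using system by (simp add: operator_system_def)

lemma LQ: "L (Q a) = scale 2 (Q a) - Q (L a)"
  using system_at(3)[of a] by (simp add: algebra_simps)

lemma RQ: "R (Q a) = Q (R a) + Q (L a) - Q a"
proof -
  have "R (Q a) = Q (R a) + Q a - L (Q a)"
    using system_at(2)[of a] by (simp add: algebra_simps)
  then show ?thesis by (simp add: LQ scale_numeral)
qed

lemma QQ: "Q (Q a) = R (R a) + L (R a) - R a"
  using system_at(1)[of a] by (simp add: algebra_simps)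

abbreviation A :: "'v \<Rightarrow> 'v" where "A a \<equiv> R a - L a"
abbreviation B :: "'v \<Rightarrow> 'v" where "B a \<equiv> R a - scale 2 (L a) - a"

text \<open>\<open>A'\<close> and \<open>B'\<close> are what \<open>A\<close> and \<open>B\<close>
  become when \<open>Q\<close> is moved to their left; \<open>C'\<close> is the cofactor in
  \<open>Q^2 = R C'\<close>.\<close>

definition A' :: "'v \<Rightarrow> 'v" where "A' a = R a + scale 2 (L a) - scale 3 a"
definition B' :: "'v \<Rightarrow> 'v" where "B' a = R a + scale 3 (L a) - scale 6 a"
definition C' :: "'v \<Rightarrow> 'v" where "C' a = R a + L a - a"

lemma A'_scale: "A' (scale c a) = scale c (A' a)"
  by (simp add: A'_def operator_simps scale_right_distrib scale_right_diff_distrib mult.commute)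

lemma B'_scale: "B' (scale c a) = scale c (B' a)"
  by (simp add: B'_def operator_simps scale_right_distrib scale_right_diff_distrib mult.commute)

lemma C'_scale: "C' (scale c a) = scale c (C' a)"
  by (simp add: C'_def operator_simps scale_right_distrib scale_right_diff_distrib)

lemma BA: "B (A a) = 0"
  using system by (simp add: operator_system_def)

lemma AB: "A (B a) = 0"
  using BA[of a] by (simp add: operator_simps LR algebra_simps)

lemma AQ: "A (Q a) = Q (A' a)"
  by (simp add: A'_def LQ RQ operator_simps scale_numeral algebra_simps)

lemma BQ: "B (Q a) = Q (B' a)"
  by (simp add: B'_def LQ RQ operator_simps scale_numeral algebra_simps)

text \<open>The commutation rules move \<open>Q\<close> to the left of \<open>B A\<close>, so that \<open>Q\<close> kills the image of
  \<open>B' A'\<close>; applying \<open>Q\<close> once more eliminates it by \<open>Q\<^sup>2 = R (R + L - 1)\<close>.\<close>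
lemma quartic: "R (C' (B' (A' a))) = 0"
proof -
  have "Q (B' (A' a)) = 0"
    using BA[of "Q a"] unfolding AQ BQ .
  then show ?thesis
    using QQ[of "B' (A' a)"] by (simp add: C'_def operator_simps LR)
qed

section \<open>Spanning by weight spaces\<close>

abbreviation S :: "'v set" where
  "S \<equiv> span (\<Union>(l, m)\<in>weights. U l m)"

text \<open>For \<open>R = L\<close> the factors \<open>A'\<close>, \<open>B'\<close>,
  \<open>C'\<close>, \<open>R\<close> of the quartic become \<open>3 (L - 1)\<close>,
  \<open>4 (L - 3/2)\<close>, \<open>2 (L - 1/2)\<close> and \<open>L\<close>, which gives the four
  weights with \<open>l = m\<close>.\<close>

lemma ker_A_subset_S:
  assumes "A a = 0"
  shows "a \<in> S"
proof -
  define y1 where "y1 = L a - scale 1 a"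
  define y2 where "y2 = L y1 - scale (3/2) y1"
  define y3 where "y3 = L y2 - scale (1/2) y2"
  define y4 where "y4 = L y3 - scale 0 y3"
  have RL: "R a = L a" "R y1 = L y1" "R y2 = L y2" "R y3 = L y3" "R (L y3) = L (L y3)"
    using assms by (simp_all add: y1_def y2_def y3_def operator_simps flip: LR)
  have 1: "A' a = scale 3 y1"
    by (simp add: A'_def RL y1_def scale_numeral algebra_simps)
  have half: "scale 4 (scale (3/2) v) = scale 6 v" "scale 2 (scale (1/2) v) = v" for v
    by (simp_all add: divide_eq_eq)
  have 2: "B' y1 = scale 4 y2"
    unfolding y2_def scale_right_diff_distrib half
    by (simp add: B'_def RL scale_numeral algebra_simps)
  have 3: "C' y2 = scale 2 y3"
    unfolding y3_def scale_right_diff_distrib half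
    by (simp add: C'_def RL scale_numeral algebra_simps)
  have "scale 3 (scale 4 (scale 2 y4)) = 0"
    using quartic[of a] unfolding 1 2 3 B'_scale C'_scale R.scale RL y4_def by simp
  then have "shifts scale L [1, 3/2, 1/2, 0] a = 0"
    by (simp add: y1_def y2_def y3_def y4_def del: scale_scale)
  moreover have "subspace {v. R v = L v}"
    by (simp add: subspace_def operator_simps)
  moreover have "distinct [1, 3/2, 1/2, 0 :: 'k]"
    by (simp add: divide_eq_eq eq_divide_eq)
  ultimately have "a \<in> span (\<Union>c\<in>set [1, 3/2, 1/2, 0]. {v \<in> {v. R v = L v}. L v = scale c v})"
    using RL(1) by (intro in_span_eigenvectors L.linear_axioms)
      (simp_all only: mem_Collect_eq flip: LR)
  also have "\<dots> \<subseteq> S"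
    by (rule span_mono) (auto simp: joint_eigenspace_def weights_def)
  finally show ?thesis .
qed

text \<open>For \<open>R = 2 L + 1\<close> the factors \<open>A'\<close>, \<open>B'\<close>,
  \<open>C'\<close>, \<open>R\<close> become \<open>4 (L - 1/2)\<close>, \<open>5 (L - 1)\<close>,
  \<open>3 L\<close> and \<open>2 (L + 1/2)\<close>, which gives the weights with
  \<open>m = 2 l + 1\<close>.\<close>

lemma ker_B_subset_S:
  assumes "B a = 0"
  shows "a \<in> S"
proof -
  define y1 where "y1 = L a - scale (1/2) a"
  define y2 where "y2 = L y1 - scale 1 y1"
  define y3 where "y3 = L y2 - scale 0 y2"
  define y4 where "y4 = L y3 - scale (- 1/2) y3"
  have RL: "R a = scale 2 (L a) + a"
    using assms by (simp add: algebra_simps)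
  \<comment> \<open>The kernel of \<open>B\<close> is stable under every \<open>L - c\<close>, since
    \<open>L\<close> commutes with \<open>R\<close>.\<close>
  have step: "R (L v - scale c v) = scale 2 (L (L v - scale c v)) + (L v - scale c v)"
    if "R v = scale 2 (L v) + v" for c v
    using that unfolding scale_numeral
    by (simp add: operator_simps scale_right_distrib algebra_simps flip: LR)
  have R1: "R y1 = scale 2 (L y1) + y1"
    unfolding y1_def by (rule step[OF RL])
  have R2: "R y2 = scale 2 (L y2) + y2"
    unfolding y2_def by (rule step[OF R1])
  have R3: "R y3 = scale 2 (L y3) + y3"
    unfolding y3_def by (rule step[OF R2])
  have half: "scale 4 (scale (1/2) v) = scale 2 v" "scale 2 (scale (- 1/2) v) = - v" for v
    by (simp_all add: divide_eq_eq)
  have 1: "A' a = scale 4 y1"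
    unfolding y1_def scale_right_diff_distrib half
    by (simp add: A'_def RL scale_numeral algebra_simps)
  have 2: "B' y1 = scale 5 y2"
    by (simp add: y2_def B'_def R1 scale_numeral algebra_simps)
  have 3: "C' y2 = scale 3 y3"
    by (simp add: y3_def C'_def R2 scale_numeral algebra_simps)
  have 4: "R y3 = scale 2 y4"
    unfolding y4_def scale_right_diff_distrib half
    by (simp add: R3 scale_numeral algebra_simps)
  have "scale 4 (scale 5 (scale 3 (scale 2 y4))) = 0"
    using quartic[of a] unfolding 1 2 3 4 B'_scale C'_scale R.scale .
  then have "shifts scale L [1/2, 1, 0, - 1/2] a = 0"
    by (simp add: y1_def y2_def y3_def y4_def del: scale_scale)
  moreover have "subspace {v. R v = scale 2 (L v) + v}"
    by (simp add: subspace_def operator_simps scale_right_distrib mult.commute add_ac)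
  moreover have "distinct [1/2, 1, 0, - 1/2 :: 'k]"
    by (simp add: divide_eq_eq eq_divide_eq)
  ultimately have "a \<in> span (\<Union>c\<in>set [1/2, 1, 0, - 1/2]. 
      {v \<in> {v. R v = scale 2 (L v) + v}. L v = scale c v})"
    using RL by (intro in_span_eigenvectors L.linear_axioms)
      (simp_all only: mem_Collect_eq L.add L.scale flip: LR)
  also have "\<dots> \<subseteq> S"
  proof (rule span_mono, rule UN_least)
    fix c :: 'k assume "c \<in> set [1/2, 1, 0, - 1/2]"
    then have "(c, 2 * c + 1) \<in> weights"
      unfolding list.set by safe (simp_all add: weights_def)
    moreover have "{v \<in> {v. R v = scale 2 (L v) + v}. L v = scale c v} \<subseteq> U c (2 * c + 1)"
      by (auto simp: joint_eigenspace_def scale_left_distrib)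
    ultimately show "{v \<in> {v. R v = scale 2 (L v) + v}. L v = scale c v}
        \<subseteq> (\<Union>(l, m)\<in>weights. U l m)"
      by blast
  qed
  finally show ?thesis .
qed

lemma eq_zero_if_eigen_minus_one:
  assumes "L w = - w"
  shows "w = 0"
proof -
  \<comment> \<open>For joint eigenvalues \<open>(-1, -1)\<close> the factors \<open>A'\<close>,
    \<open>B'\<close>, \<open>C'\<close>, \<open>R\<close> are -6, -10, -3 and -1, so the quartic
    forces \<open>v = 0\<close>.\<close>
  have zero: "v = 0" if v: "L v = - v" "R v = - v" for v
  proof -
    define z where "z = B' (A' v)"
    have "A' v = - scale 6 v" "B' v = - scale 10 v"
      by (simp_all add: A'_def B'_def v scale_numeral algebra_simps)
    then have z: "z = scale 10 (scale 6 v)"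
      using A'_scale[of "- 6" v] B'_scale[of "- 6" v] by (simp add: z_def)
    then have "L z = - z" "R z = - z"
      by (simp_all add: operator_simps v)
    then have "scale 3 z = 0"
      using quartic[of v] by (simp add: C'_def z_def[symmetric] operator_simps scale_numeral)
    then show ?thesis by (simp add: z del: scale_scale)
  qed
  have LRw: "L (R w) = - R w"
    using assms by (simp add: LR operator_simps)
  \<comment> \<open>Where \<open>L = -1\<close>, both \<open>A\<close> and \<open>B\<close> equal
    \<open>R + 1\<close>, so \<open>(R + 1)^2 w = 0\<close>. The joint case is therefore applied
    twice, first to \<open>R w + w\<close> and then to \<open>w\<close>.\<close>
  have "L (R w + w) = - (R w + w)"
    using assms LRw by (simp add: operator_simps)
  moreover have "R (R w + w) = - (R w + w)"
    using BA[of w] assms LRw by (simp add: operator_simps scale_numeral algebra_simps eq_neg_iff_add_eq_0)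
  ultimately have "R w + w = 0" by (rule zero)
  then show ?thesis
    using assms by (intro zero) (simp_all add: eq_neg_iff_add_eq_0)
qed

lemma S_eq_UNIV: "S = UNIV"
proof (intro set_eqI iffI UNIV_I)
  fix x
  have "A x - B x \<in> S"
    using ker_B_subset_S[OF BA] ker_A_subset_S[OF AB] by (rule span_diff)
  moreover have "A x - B x = L x + x"
    by (simp add: scale_numeral algebra_simps)
  ultimately have "L x + x \<in> S"
    by (simp only:)
  moreover have "\<exists>c. c \<noteq> - 1 \<and> L v = scale c v" if v: "v \<in> (\<Union>(l, m)\<in>weights. U l m)" for v
  proof -
    obtain l m where "(l, m) \<in> weights" "v \<in> U l m" using v by auto
    then show ?thesis
      using weights_neq_minus_one by (auto simp: joint_eigenspace_def)
  qed
  \<comment> \<open>\<open>L + 1\<close> maps \<open>S\<close> onto itself, so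
    \<open>(L + 1) x\<close> has a preimage \<open>z\<close> in \<open>S\<close>; the difference
    \<open>x - z\<close> is killed by \<open>L + 1\<close>, hence zero.\<close>
  ultimately obtain z where z: "z \<in> S" "L z - scale (- 1) z = L x + x"
    using shift_surj_on_span_eigenvectors[OF L.linear_axioms, of "\<Union>(l, m)\<in>weights. U l m" "- 1"]
    by meson
  then have "L (x - z) = - (x - z)"
    by (simp add: operator_simps algebra_simps)
  then show "x \<in> S"
    using z(1) eq_zero_if_eigen_minus_one by fastforce
qed

section \<open>Action of \<open>Q\<close> on the weight spaces\<close>

lemma Q_joint_eigenspace:
  assumes "a \<in> U l m"
  shows "Q a \<in> U (2 - l) (m + l - 1)"
  using assms by (simp add: joint_eigenspace_def LQ RQ operator_simps scale_left_distrib
      scale_left_diff_distrib)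

lemma QQ_joint_eigenspace:
  assumes "a \<in> U l m"
  shows "Q (Q a) = scale (m * m + l * m - m) a"
  using assms by (simp add: joint_eigenspace_def QQ operator_simps scale_left_distrib
      scale_left_diff_distrib mult.commute)

text \<open>\<open>Q B' A' = 0\<close>, and \<open>B' A'\<close> acts on a weight space as the
  scalar \<open>(m + 3 l - 6) (m + 2 l - 3)\<close>. The hypotheses carry these factors doubled,
  which clears the denominators of half-integral weights.\<close>

lemma Q_eq_zero:
  assumes a: "a \<in> U l m" and "2 * m + 6 * l - 12 \<noteq> 0" and "2 * m + 4 * l - 6 \<noteq> 0"
  shows "Q a = 0"
proof -
  have "Q (B' (A' a)) = 0"
    using BA[of "Q a"] unfolding AQ BQ .
  moreover have "A' a = scale (m + 2 * l - 3) a" "B' a = scale (m + 3 * l - 6) a"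
    using a by (simp_all add: joint_eigenspace_def A'_def B'_def scale_left_distrib
        scale_left_diff_distrib)
  ultimately have "scale (m + 2 * l - 3) (scale (m + 3 * l - 6) (Q a)) = 0"
    by (simp add: B'_scale operator_simps del: scale_scale)
  moreover have "m + 2 * l - 3 \<noteq> 0" "m + 3 * l - 6 \<noteq> 0"
    using assms(2,3) mult_eq_0_iff[of 2 "m + 2 * l - 3"] mult_eq_0_iff[of 2 "m + 3 * l - 6"]
    by (auto simp: algebra_simps)
  ultimately show ?thesis by simp
qed

lemma direct_sum_weights: "internal_direct_sum scale weights (\<lambda>(l, m). U l m) UNIV"
proof (rule internal_direct_sumI)
  show "finite (weights :: ('k \<times> 'k) set)" by (simp add: weights_def)
  then show "f w = 0"
    if "\<And>w. w \<in> weights \<Longrightarrow> f w \<in> (case w of (l, m) \<Rightarrow> U l m)" "(\<Sum>w\<in>weights. f w) = 0"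
      and "w \<in> weights" for f w
    using that
    by (intro joint_eigenvectors_independent[OF L.linear_axioms R.linear_axioms]) fastforce+
qed (auto simp: subspace_joint_eigenspace S_eq_UNIV)

lemma kills_four: "kills_four Q U"
proof -
  have "2 * (1/2) + 6 * (1/2) - 12 = (- 8 :: 'k)" "2 * (1/2) + 4 * (1/2) - 6 = (- 3 :: 'k)"
    "2 * 0 + 6 * (- 1/2) - 12 = (- 15 :: 'k)" "2 * 0 + 4 * (- 1/2) - 6 = (- 8 :: 'k)"
    by (simp_all add: field_simps)
  then have "Q a = 0" if "a \<in> U (1/2) (1/2) \<union> U (- 1/2) 0" for a
    using Q_eq_zero[of a "1/2" "1/2"] Q_eq_zero[of a "- 1/2" 0] that
    by (metis UnE neg_equal_0_iff_equal numeral_nonzero three)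
  moreover have "Q a = 0" if "a \<in> U 0 0 \<union> U 0 1" for a
    using Q_eq_zero[of a 0 0] Q_eq_zero[of a 0 1] that by auto
  ultimately show ?thesis
    unfolding kills_four_def by blast
qed

text \<open>The weights \<open>(1, 1)\<close> and \<open>(1, 3)\<close> are fixed by
  \<open>(l, m) \<mapsto> (2 - l, m + l - 1)\<close>, and \<open>Q^2\<close> is 1 and 9
  there.\<close>

lemma splits_by_sign: "splits_by_sign scale Q U"
  unfolding splits_by_sign_def
proof (intro exI conjI)
  show "internal_direct_sum scale {1, - 1} (\<lambda>e. {a \<in> U 1 1. Q a = scale (e * 1) a}) (U 1 1)"
    by (rule involution_splits[OF Q.linear_axioms subspace_joint_eigenspace])
      (use Q_joint_eigenspace[of _ 1 1] QQ_joint_eigenspace[of _ 1 1] in auto)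
  show "internal_direct_sum scale {1, - 1} (\<lambda>e. {a \<in> U 1 3. Q a = scale (e * 3) a}) (U 1 3)"
    by (rule involution_splits[OF Q.linear_axioms subspace_joint_eigenspace])
      (use Q_joint_eigenspace[of _ 1 3] QQ_joint_eigenspace[of _ 1 3] in auto)
qed auto

text \<open>\<open>Q\<close> exchanges the two weight spaces and \<open>Q^2 = 3\<close> on both, so
  \<open>Q / s\<close> is the required involution.\<close>

lemma acts_by_interchange:
  assumes s: "s ^ 2 = 3"
  shows "acts_by_interchange scale s Q U"
proof -
  let ?A = "U (3/2) (3/2)" and ?B = "U (1/2) 2"
  define t where "t x = scale (1 / s) (Q x)" for x
  have s0: "s \<noteq> 0" using s by auto
  have weight: "2 - 3/2 = (1/2 :: 'k)" "3/2 + 3/2 - 1 = (2 :: 'k)"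
    "2 - 1/2 = (3/2 :: 'k)" "2 + 1/2 - 1 = (3/2 :: 'k)"
    by (simp_all add: field_simps)
  have "x \<in> ?A \<Longrightarrow> t x \<in> ?B" and "x \<in> ?B \<Longrightarrow> t x \<in> ?A" for x
    using Q_joint_eigenspace[of x "3/2" "3/2", unfolded weight]
      Q_joint_eigenspace[of x "1/2" 2, unfolded weight]
    by (simp_all add: t_def subspace_scale subspace_joint_eigenspace)
  note tAB = this
  have "3/2 * (3/2) + 3/2 * (3/2) - 3/2 = (3 :: 'k)" "2 * 2 + 1/2 * 2 - 2 = (3 :: 'k)"
    by (simp_all add: field_simps)
  then have "?A \<union> ?B \<subseteq> {x. Q (Q x) = scale 3 x}"
    using QQ_joint_eigenspace[of _ "3/2" "3/2"] QQ_joint_eigenspace[of _ "1/2" 2] by auto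
  \<comment> \<open>The involution law is required on the whole span; the vectors with
    \<open>Q^2 x = 3 x\<close> form a subspace, so checking the generators suffices.\<close>
  then have "span (?A \<union> ?B) \<subseteq> {x. Q (Q x) = scale 3 x}"
    by (rule span_minimal)
      (auto simp: subspace_def operator_simps scale_right_distrib mult.commute)
  then have tt: "t (t x) = x" if "x \<in> span (?A \<union> ?B)" for x
    using that s0 s by (auto simp: t_def operator_simps power2_eq_square)
  have ttA: "t (t x) = x" if "x \<in> ?A" for x
    using that by (intro tt span_base) simp
  have ttB: "t (t x) = x" if "x \<in> ?B" for x
    using that by (intro tt span_base) simp
  have "t ` ?A = ?B"
    using tAB ttB by (metis image_eqI image_subsetI subsetI subset_antisym)
  moreover have "t ` ?B = ?A"
    using tAB ttA by (metis image_eqI image_subsetI subsetI subset_antisym)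
  ultimately have "linear_interchange scale ?A ?B t"
    using tt unfolding linear_interchange_def Let_def
    by (auto simp: t_def operator_simps scale_right_distrib mult.commute)
  moreover have "Q a = scale s (t a)" for a
    using s0 by (simp add: t_def)
  ultimately show ?thesis
    unfolding acts_by_interchange_def by blast
qed

end

section \<open>The converse\<close>

context three_operators
begin

text \<open>The system at a single vector, each equation written as the vanishing of a linear map,
  so that the solutions form a subspace.\<close>

definition solution :: "'v \<Rightarrow> bool" where
  "solution a \<longleftrightarrow>
     R (R a) - Q (Q a) + L (R a) - R a = 0 \<and>
     R (Q a) - Q (R a) + L (Q a) - Q a = 0 \<and>
     L (R a) - R (L a) = 0 \<and>
     L (Q a) + Q (L a) - scale 2 (Q a) = 0 \<and>
     R (R a - L a) - scale 2 (L (R a - L a)) - (R a - L a) = 0"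

lemma subspace_solutions: "subspace {a. solution a}"
proof -
  have ker: "subspace {a. F a = 0}"
    if "\<And>x y. F (x + y) = F x + F y" "\<And>c x. F (scale c x) = scale c (F x)" for F :: "'v \<Rightarrow> 'v"
    using that(1)[of 0 0] by (auto simp: subspace_def that)
  show ?thesis
    unfolding solution_def Collect_conj_eq
    by (intro subspace_inter ker)
      (simp_all add: operator_simps scale_right_distrib scale_right_diff_distrib mult.commute)
qed

text \<open>One computation for all summands: \<open>b = 0\<close> where \<open>Q\<close> vanishes,
  \<open>b = a\<close> on the signed parts, and \<open>b = t a\<close> on the interchanged
  pair.\<close>

lemma solutionI:
  assumes a: "L a = scale l a" "R a = scale m a" "Q a = scale q b"
    and b: "L b = scale l' b" "R b = scale m' b" "Q b = scale q' a"
    and eqs: "m * m - q * q' + l * m - m = 0" "m' - m + l' - 1 = 0" "l' + l - 2 = 0"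
      "(m - 2 * l - 1) * (m - l) = 0"
  shows "solution a"
proof -
  have "R (R a) - Q (Q a) + L (R a) - R a = scale (m * m - q * q' + l * m - m) a"
    by (simp add: a b operator_simps scale_left_distrib scale_left_diff_distrib mult.commute)
  moreover have "R (Q a) - Q (R a) + L (Q a) - Q a = scale (q * (m' - m + l' - 1)) b"
    by (simp add: a b operator_simps scale_left_distrib scale_left_diff_distrib algebra_simps)
  moreover have "L (R a) - R (L a) = 0"
    by (simp add: a operator_simps mult.commute)
  moreover have "L (Q a) + Q (L a) - scale 2 (Q a) = scale (q * (l' + l - 2)) b"
    by (simp add: a b operator_simps scale_left_distrib scale_left_diff_distrib algebra_simps)
  moreover have "R (R a - L a) - scale 2 (L (R a - L a)) - (R a - L a)
      = scale ((m - 2 * l - 1) * (m - l)) a"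
  proof -
    have "R a - L a = scale (m - l) a"
      by (simp add: a scale_left_diff_distrib)
    then show ?thesis
      by (simp only: L.scale R.scale a scale_scale scale_left_diff_distrib[symmetric])
        (simp add: algebra_simps)
  qed
  ultimately show ?thesis
    unfolding solution_def eqs by simp
qed

lemma operator_systemI:
  assumes s: "s ^ 2 = 3"
    and sum: "internal_direct_sum scale weights (\<lambda>(l, m). V l m) UNIV"
    and LR: "acts_by_weights scale L R V"
    and kills: "kills_four Q V"
    and splits: "splits_by_sign scale Q V"
    and inter: "acts_by_interchange scale s Q V"
  shows "operator_system scale L R Q"
proof -
  have LRV: "L a = scale l a" "R a = scale m a" if "(l, m) \<in> weights" "a \<in> V l m" for a l m
    using LR that by (auto simp: acts_by_weights_def)
  have killed: "V l m \<subseteq> {a. solution a}"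
    if lm: "(l, m) \<in> {(0, 0), (1/2, 1/2), (0, 1), (- 1/2, 0)}" for l m
  proof
    fix a assume a: "a \<in> V l m"
    have eqs: "m * m + l * m - m = 0" "(m - 2 * l - 1) * (m - l) = 0"
      using lm by (safe; simp add: field_simps)+
    have "a \<in> V 0 0 \<union> V (1/2) (1/2) \<union> V 0 1 \<union> V (- 1/2) 0"
      using lm a by blast
    then have "Q a = scale 0 0"
      using kills by (simp only: kills_four_def scale_zero_left)
    moreover have "(l, m) \<in> weights" using lm by (auto simp: weights_def)
    ultimately have "solution a"
      using a eqs
      \<comment> \<open>As \<open>b = 0\<close>, any \<open>l'\<close> and \<open>m'\<close> are
        eigenvalues for it; these solve the scalar equations.\<close>
      by (intro solutionI[where b = 0 and l' = "2 - l" and m' = "m + l - 1" and q' = 0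
            and l = l and m = m and q = 0])
        (auto simp: LRV operator_simps)
    then show "a \<in> {a. solution a}" by simp
  qed
  obtain V11 V13 :: "'k \<Rightarrow> 'v set"
    where V11: "internal_direct_sum scale {1, - 1} V11 (V 1 1)"
      and V13: "internal_direct_sum scale {1, - 1} V13 (V 1 3)"
      and Q11: "\<And>e a. e \<in> {1, - 1} \<Longrightarrow> a \<in> V11 e \<Longrightarrow> Q a = scale e a"
      and Q13: "\<And>e a. e \<in> {1, - 1} \<Longrightarrow> a \<in> V13 e \<Longrightarrow> Q a = scale (e * 3) a"
    using splits unfolding splits_by_sign_def by metis
  have s11: "V 1 1 \<subseteq> {a. solution a}"
  proof (rule internal_direct_sum_subset[OF V11 subspace_solutions], rule subsetI)
    fix e a assume e: "e \<in> {1, - 1}" and a: "a \<in> V11 e"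
    then have "a \<in> V 1 1" using internal_direct_sum_component_subset[OF V11] by blast
    then have "solution a"
      using Q11[OF e a] LRV[of 1 1 a] e
      by (intro solutionI[where b = a and q = e and q' = e and l = 1 and l' = 1 and m = 1 and m' = 1])
        (auto simp: weights_def)
    then show "a \<in> {a. solution a}" by simp
  qed
  have s13: "V 1 3 \<subseteq> {a. solution a}"
  proof (rule internal_direct_sum_subset[OF V13 subspace_solutions], rule subsetI)
    fix e a assume e: "e \<in> {1, - 1}" and a: "a \<in> V13 e"
    then have "a \<in> V 1 3" using internal_direct_sum_component_subset[OF V13] by blast
    then have "solution a"
      using Q13[OF e a] LRV[of 1 3 a] e
      by (intro solutionI[where b = a and q = "e * 3" and q' = "e * 3"
            and l = 1 and l' = 1 and m = 3 and m' = 3])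
        (auto simp: weights_def)
    then show "a \<in> {a. solution a}" by simp
  qed
  let ?A = "V (3/2) (3/2)" and ?B = "V (1/2) 2"
  obtain t where t: "linear_interchange scale ?A ?B t"
    and Qt: "\<And>a. a \<in> ?A \<union> ?B \<Longrightarrow> Q a = scale s (t a)"
    using inter unfolding acts_by_interchange_def by blast
  have tAB: "t ` ?A = ?B" "t ` ?B = ?A"
    and tt: "\<And>a. a \<in> ?A \<union> ?B \<Longrightarrow> t (t a) = a"
    using t span_superset[of "?A \<union> ?B"] unfolding linear_interchange_def Let_def by blast+
  have w: "(3/2, 3/2) \<in> (weights :: ('k \<times> 'k) set)" "(1/2, 2) \<in> (weights :: ('k \<times> 'k) set)"
    by (simp_all add: weights_def)
  have ss: "s * s = 3" using s by (simp add: power2_eq_square)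
  have sA: "?A \<subseteq> {a. solution a}"
  proof
    fix a assume a: "a \<in> ?A"
    then have ta: "t a \<in> ?B" using tAB by blast
    have "solution a"
    proof (rule solutionI[where l = "3/2" and m = "3/2" and l' = "1/2" and m' = 2])
      show "Q a = scale s (t a)" "Q (t a) = scale s a"
        using Qt[of a] Qt[of "t a"] tt[of a] a ta by simp_all
    qed (rule LRV[OF w(1) a] LRV[OF w(2) ta] | simp add: ss field_simps)+
    then show "a \<in> {a. solution a}" by simp
  qed
  have sB: "?B \<subseteq> {a. solution a}"
  proof
    fix a assume a: "a \<in> ?B"
    then have ta: "t a \<in> ?A" using tAB by blast
    have "solution a"
    proof (rule solutionI[where l = "1/2" and m = 2 and l' = "3/2" and m' = "3/2"])
      show "Q a = scale s (t a)" "Q (t a) = scale s a"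
        using Qt[of a] Qt[of "t a"] tt[of a] a ta by simp_all
    qed (rule LRV[OF w(2) a] LRV[OF w(1) ta] | simp add: ss field_simps)+
    then show "a \<in> {a. solution a}" by simp
  qed
  have "UNIV \<subseteq> {a. solution a}"
  proof (rule internal_direct_sum_subset[OF sum subspace_solutions])
    fix w :: "'k \<times> 'k" assume "w \<in> weights"
    then show "(case w of (l, m) \<Rightarrow> V l m) \<subseteq> {a. solution a}"
      using killed[of 0 0] killed[of "1/2" "1/2"] killed[of 0 1] killed[of "- 1/2" 0] s11 s13 sA sB
      unfolding weights_def by (elim insertE emptyE) simp_all
  qed
  then show ?thesis
    by (auto simp: operator_system_def solution_def)
qed

end

section \<open>The characteristic and both directions together\<close>

lemma numerals_nonzero_if_CHAR:
  assumes "CHAR('k::field) \<noteq> 2" "CHAR('k) \<noteq> 3" "CHAR('k) \<noteq> 5"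
  shows "(2 :: 'k) \<noteq> 0" "(3 :: 'k) \<noteq> 0" "(5 :: 'k) \<noteq> 0"
proof -
  \<comment> \<open>If \<open>p\<close> vanishes in the field, the characteristic divides
    \<open>p\<close>, so it is 1 or \<open>p\<close>; a field excludes 1.\<close>
  have prime: "of_nat p \<noteq> (0 :: 'k)" if "p > 0" "\<And>d. d dvd p \<Longrightarrow> d = 1 \<or> d = p" "CHAR('k) \<noteq> p" for p
    using that(2)[of "CHAR('k)"] that CHAR_not_1[where ?'a = 'k]
    by (auto simp: of_nat_eq_0_iff_char_dvd)
  have "d = 1 \<or> d = 2" if "d dvd 2" for d :: nat
    using dvd_imp_le[OF that] that by (auto simp: le_Suc_eq numeral_eq_Suc)
  then show "(2 :: 'k) \<noteq> 0" using prime[of 2] assms by simp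
  have "d = 1 \<or> d = 3" if "d dvd 3" for d :: nat
  proof -
    have "d \<in> {0, 1, 2, 3}" using dvd_imp_le[OF that] by auto
    then show ?thesis using that by auto
  qed
  then show "(3 :: 'k) \<noteq> 0" using prime[of 3] assms by simp
  have "d = 1 \<or> d = 5" if "d dvd 5" for d :: nat
  proof -
    have "d \<in> {0, 1, 2, 3, 4, 5}" using dvd_imp_le[OF that] by auto
    then show ?thesis using that by auto
  qed
  then show "(5 :: 'k) \<noteq> 0" using prime[of 5] assms by simp
qed

theorem theorem1p1:
  fixes scale :: "'k::field \<Rightarrow> 'v::ab_group_add \<Rightarrow> 'v"
    and L R Q :: "'v \<Rightarrow> 'v"
  assumes "vector_space scale"
    and "CHAR('k) \<noteq> 2" and "CHAR('k) \<noteq> 3" and "CHAR('k) \<noteq> 5"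
    and "Vector_Spaces.linear scale scale L"
    and "Vector_Spaces.linear scale scale R"
    and "Vector_Spaces.linear scale scale Q"
  shows "(operator_system scale L R Q \<longrightarrow>
            (let U = joint_eigenspace scale L R in
               internal_direct_sum scale weights (\<lambda>(l, m). U l m) UNIV \<and>
               acts_by_weights scale L R U \<and>
               kills_four Q U \<and>
               splits_by_sign scale Q U \<and>
               (\<forall>s. s ^ 2 = 3 \<longrightarrow> acts_by_interchange scale s Q U)))
       \<and> (\<forall>(U :: 'k \<Rightarrow> 'k \<Rightarrow> 'v set) s.
            s ^ 2 = 3 \<longrightarrow>
            internal_direct_sum scale weights (\<lambda>(l, m). U l m) UNIV \<longrightarrow>
            acts_by_weights scale L R U \<longrightarrow>
            kills_four Q U \<longrightarrow>
            splits_by_sign scale Q U \<longrightarrow>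
            acts_by_interchange scale s Q U \<longrightarrow>
            operator_system scale L R Q)"
proof -
  interpret three_operators scale L R Q
    using assms numerals_nonzero_if_CHAR[where ?'k = 'k]
    by (simp add: three_operators_def three_operators_axioms_def)
  show ?thesis
  proof (intro conjI impI allI)
    assume "operator_system scale L R Q"
    then interpret three_operators_system scale L R Q
      by unfold_locales
    have "acts_by_weights scale L R U"
      by (auto simp: acts_by_weights_def joint_eigenspace_def)
    then show "let U = joint_eigenspace scale L R in
        internal_direct_sum scale weights (\<lambda>(l, m). U l m) UNIV \<and>
        acts_by_weights scale L R U \<and> kills_four Q U \<and> splits_by_sign scale Q U \<and>
        (\<forall>s. s ^ 2 = 3 \<longrightarrow> acts_by_interchange scale s Q U)"
      unfolding Let_def
      using direct_sum_weights kills_four splits_by_sign acts_by_interchange by blast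
  qed (rule operator_systemI)
qed

end
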